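(* Let $n \ge 1$ and let $\mathcal{P}$ be a distinct pair-sum (dps) polytope in $\mathbb{R}^n$. Then $N(\mathcal{P}) \le 2^n$, where $N(\mathcal{P}) = |\mathcal{P} \cap \mathbb{Z}^n|$.
   Context: A lattice polytope $\mathcal{P}$ in $\mathbb{R}^n$ is the convex hull of a finite subset of $\mathbb{Z}^n$ (it is not required to be full-dimensional). Write $\mathcal{L}(\mathcal{P}) := \mathcal{P} \cap \mathbb{Z}^n = \{v_1,\dots,v_N\}$, where $N = N(\mathcal{P}) := |\mathcal{L}(\mathcal{P})|$. The lattice polytope $\mathcal{P}$ is called a distinct pair-sum (dps) polytope if the $N + \binom{N}{2}$ sums $2v_1,\dots,2v_N$ and $v_i+v_j$ ($1 \le i<j\le N$) are all distinct, i.e. $v_i + v_j = v_k + v_\ell$ implies $\{i,j\}=\{k,\ell\}$ as multisets. *)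

theory Defs
  imports "HOL-Analysis.Analysis" "HOL-Library.Multiset"
begin

definition integer_lattice :: "(real ^ 'n) set" where
  "integer_lattice = {x. \<forall>i. x $ i \<in> \<int>}"

definition lattice_polytope :: "(real ^ 'n) set \<Rightarrow> bool" where
  "lattice_polytope P \<longleftrightarrow> (\<exists>S. finite S \<and> S \<subseteq> integer_lattice \<and> P = convex hull S)"

definition lattice_points :: "(real ^ 'n) set \<Rightarrow> (real ^ 'n) set" where
  "lattice_points P = P \<inter> integer_lattice"

definition num_lattice_points :: "(real ^ 'n) set \<Rightarrow> nat" where
  "num_lattice_points P = card (lattice_points P)"

text \<open>The points \<open>v\<^sub>1, \<dots>, v\<^sub>N\<close> are pairwise distinct, so equality of multisets of indices
  is the same as equality of multisets of lattice points.\<close>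

definition dps_polytope :: "(real ^ 'n) set \<Rightarrow> bool" where
  "dps_polytope P \<longleftrightarrow> lattice_polytope P \<and>
     (\<forall>u \<in> lattice_points P. \<forall>v \<in> lattice_points P.
      \<forall>w \<in> lattice_points P. \<forall>x \<in> lattice_points P.
        u + v = w + x \<longrightarrow> {#u, v#} = {#w, x#})"

text \<open>Since \<^const>\<open>card\<close> is 0 on infinite sets, the following fact is what makes
  \<^const>\<open>num_lattice_points\<close> the number of lattice points of a lattice polytope.\<close>

lemma finite_lattice_points:
  fixes P :: "(real ^ 'n) set"
  assumes "lattice_polytope P"
  shows "finite (lattice_points P)"
proof -
  have "bounded P"
    using assms by (auto simp: lattice_polytope_def intro: finite_imp_bounded bounded_convex_hull)
  then obtain b where b: "\<And>x. x \<in> P \<Longrightarrow> norm x \<le> b"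
    by (auto simp: bounded_iff)
  let ?F = "PiE (UNIV :: 'n set) (\<lambda>_. {- \<lceil>b\<rceil>..\<lceil>b\<rceil>})"
  have "lattice_points P \<subseteq> (\<lambda>f. \<chi> i. of_int (f i)) ` ?F"
  proof
    fix x assume x: "x \<in> lattice_points P"
    then have int: "of_int \<lfloor>x $ i\<rfloor> = x $ i" for i
      by (simp add: lattice_points_def integer_lattice_def)
    have "\<bar>x $ i\<bar> \<le> b" for i
      using x b[of x] component_le_norm_cart[of x i] by (simp add: lattice_points_def)
    then have "real_of_int \<bar>\<lfloor>x $ i\<rfloor>\<bar> \<le> real_of_int \<lceil>b\<rceil>" for i
      using int[of i] by (metis le_of_int_ceiling of_int_abs order_trans)
    then have "\<bar>\<lfloor>x $ i\<rfloor>\<bar> \<le> \<lceil>b\<rceil>" for i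
      using of_int_le_iff by blast
    then have "(\<lambda>i. \<lfloor>x $ i\<rfloor>) \<in> ?F"
      by (auto simp: PiE_def abs_le_iff minus_le_iff)
    moreover have "x = (\<chi> i. of_int \<lfloor>x $ i\<rfloor>)"
      by (simp add: vec_eq_iff int)
    ultimately show "x \<in> (\<lambda>f. \<chi> i. of_int (f i)) ` ?F"
      using image_eqI[where f = "\<lambda>f. \<chi> i. of_int (f i)" and x = "\<lambda>i. \<lfloor>x $ i\<rfloor>"] by blast
  qed
  moreover have "finite ?F"
    by (intro finite_PiE) auto
  ultimately show ?thesis
    by (blast intro: finite_subset)
qed

end

theory Submission
  imports Defs
begin

text \<open>Two lattice points of a dps polytope with the same coordinate parities have a lattice midpoint
  \<open>m\<close> in the polytope, and \<open>u + v = m + m\<close> forces \<open>u = v\<close>. So lattice points are determined by their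
  parity classes, of which there are \<open>2\<^sup>n\<close>.\<close>

text \<open>A class in (Z/2)^n is encoded as a subset of the index type, so that counting classes
  means counting a power set. On lattice points the floor changes nothing.\<close>

definition even_coords :: "real ^ 'n \<Rightarrow> 'n set" where
  "even_coords x = {i. even \<lfloor>x $ i\<rfloor>}"

text \<open>Integers of equal parity have an even sum, so halving each coordinate of
  \<open>u + v\<close> stays in the integers.\<close>

lemma midpoint_in_integer_lattice:
  assumes "u \<in> integer_lattice" "v \<in> integer_lattice" "even_coords u = even_coords v"
  shows "midpoint u v \<in> integer_lattice"
  unfolding integer_lattice_def
proof (intro CollectI allI)
  fix i
  have floor_eq: "of_int \<lfloor>u $ i\<rfloor> = u $ i" "of_int \<lfloor>v $ i\<rfloor> = v $ i"
    using assms(1,2) by (simp_all add: integer_lattice_def)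
  have "even \<lfloor>u $ i\<rfloor> \<longleftrightarrow> even \<lfloor>v $ i\<rfloor>"
    using assms(3) by (auto simp: even_coords_def)
  then obtain k where k: "\<lfloor>u $ i\<rfloor> + \<lfloor>v $ i\<rfloor> = 2 * k"
    by (metis even_add evenE)
  have "u $ i + v $ i = 2 * of_int k"
    using arg_cong[OF k, of real_of_int] floor_eq by simp
  then have "midpoint u v $ i = of_int k"
    by (simp add: midpoint_def)
  then show "midpoint u v $ i \<in> \<int>"
    by simp
qed

lemma inj_on_even_coords:
  assumes "dps_polytope P"
  shows "inj_on even_coords (lattice_points P)"
proof (rule inj_onI)
  fix u v
  assume u: "u \<in> lattice_points P" and v: "v \<in> lattice_points P"
    and eq: "even_coords u = even_coords v"
  have "convex P"
    using assms by (auto simp: dps_polytope_def lattice_polytope_def)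
  then have "midpoint u v \<in> P"
    using u v by (metis IntD1 convex_contains_segment lattice_points_def midpoint_in_closed_segment subsetD)
  then have m: "midpoint u v \<in> lattice_points P"
    using u v eq midpoint_in_integer_lattice by (auto simp: lattice_points_def)
  have "u + v = midpoint u v + midpoint u v"
    by (simp add: midpoint_plus_self)
  \<comment> \<open>The dps condition is used with the midpoint as both summands on one side; the
    resulting multiset has only one distinct element.\<close>
  then have "{#u, v#} = {#midpoint u v, midpoint u v#}"
    using assms u v m unfolding dps_polytope_def by blast
  then show "u = v"
    by (auto simp: add_eq_conv_ex)
qed

theorem theorem2:
  fixes P :: "(real ^ 'n) set"
  assumes "dps_polytope P"
  shows "num_lattice_points P \<le> 2 ^ CARD('n)"
proof -
  \<comment> \<open>The target is finite, so the injection bounds a genuine count, not the default 0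
    of \<open>card\<close>.\<close>
  have "card (lattice_points P) \<le> card (Pow (UNIV :: 'n set))"
    by (rule card_inj_on_le[OF inj_on_even_coords[OF assms]]) auto
  then show ?thesis
    by (simp add: num_lattice_points_def card_Pow)
qed

end
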